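(* Let $(X,d)$ be a proper metric space and let $n\geq 2$ be an integer. The best constant $K_n^*$ associated with the Fermat $n$-distance $d_F$ on $X$ satisfies $$K_n^*\leq\frac{4n-4}{3n^2-4n}.$$
   Context: Metric spaces are nonempty. A metric space is proper if every closed ball is compact. The Fermat $n$-distance on a proper metric space $(X,d)$ is the map $d_F\colon X^n\to[0,+\infty[$, $d_F(x_1,\ldots,x_n)=\min_{x\in X}\sum_{i=1}^n d(x_i,x)$ (the minimum is attained). For a function $f\colon X^n\to[0,+\infty[$, $f(x_1,\ldots,x_n)_i^z$ denotes the value of $f$ at $(x_1,\ldots,x_{i-1},z,x_{i+1},\ldots,x_n)$. An $n$-distance on a nonempty set $X$ is a symmetric function $f\colon X^n\to[0,+\infty[$ with $f(x_1,\ldots,x_n)=0$ if and only if $x_1=\cdots=x_n$, and with $f(x_1,\ldots,x_n)\leq\sum_{i=1}^n f(x_1,\ldots,x_n)_i^z$ for all $x_1,\ldots,x_n,z\in X$. The map $d_F$ is an $n$-distance. The best constant associated with an $n$-distance $f$ is the infimum of the set of real numbers $K\in\,]0,1]$ such that $f(x_1,\ldots,x_n)\leq K\sum_{i=1}^n f(x_1,\ldots,x_n)_i^z$ for all $x_1,\ldots,x_n,z\in X$. *)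

theory Defs
  imports "HOL-Analysis.Analysis"
begin

definition proper_metric_space :: "'a set \<Rightarrow> ('a \<Rightarrow> 'a \<Rightarrow> real) \<Rightarrow> bool" where
  "proper_metric_space X d \<longleftrightarrow>
     Metric_space X d \<and> X \<noteq> {} \<and>
     (\<forall>a\<in>X. \<forall>r. compactin (Metric_space.mtopology X d) (Metric_space.mcball X d a r))"

text \<open>
  Points of \<open>X\<^sup>n\<close> are the extensional functions in \<open>{1..n} \<rightarrow>\<^sub>E X\<close>; replacing the
  \<open>i\<close>-th component by \<open>z\<close> is the function update \<open>x(i := z)\<close>.

  The least value below is genuinely attained on a proper space when \<open>n \<ge> 1\<close>, see
  \<open>fermat_distance_attained\<close>.
\<close>

definition fermat_distance :: "nat \<Rightarrow> 'a set \<Rightarrow> ('a \<Rightarrow> 'a \<Rightarrow> real) \<Rightarrow> (nat \<Rightarrow> 'a) \<Rightarrow> real" where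
  "fermat_distance n X d x = (LEAST s. \<exists>y\<in>X. s = (\<Sum>i=1..n. d (x i) y))"

text \<open>
  For an \<open>n\<close>-distance \<open>f\<close> the set of constants contains \<open>1\<close> and is bounded below by \<open>0\<close>,
  so that the real-valued \<^const>\<open>Inf\<close> is the true infimum.
\<close>

definition best_constant :: "nat \<Rightarrow> 'a set \<Rightarrow> ((nat \<Rightarrow> 'a) \<Rightarrow> real) \<Rightarrow> real" where
  "best_constant n X f =
     Inf {K. 0 < K \<and> K \<le> 1 \<and>
             (\<forall>x \<in> {1..n} \<rightarrow>\<^sub>E X. \<forall>z\<in>X. f x \<le> K * (\<Sum>i=1..n. f (x(i := z))))}"

lemma fermat_distance_attained:
  assumes X: "proper_metric_space X d" and n: "n \<ge> 1" and x: "x \<in> {1..n} \<rightarrow>\<^sub>E X"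
  shows "\<exists>y\<in>X. fermat_distance n X d x = (\<Sum>i=1..n. d (x i) y) \<and>
               (\<forall>z\<in>X. (\<Sum>i=1..n. d (x i) y) \<le> (\<Sum>i=1..n. d (x i) z))"
proof -
  interpret Metric_space X d
    using X by (simp add: proper_metric_space_def)
  define S where "S = (\<lambda>y. \<Sum>i=1..n. d (x i) y)"
  define C where "C = mcball (x 1) (S (x 1))"
  have xi: "x i \<in> X" if "i \<in> {1..n}" for i
    using x that by auto
  have S0: "0 \<le> S y" for y
    by (simp add: S_def sum_nonneg)
  have "continuous_map mtopology euclideanreal (d (x i))" if "i \<in> {1..n}" for i
    using continuous_map_mdist_alt[of mtopology "metric (X, d)" "\<lambda>y. (x i, y)"] xi[OF that]
    by (simp add: continuous_map_pairedI mtopology_of_def)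
  then have "continuous_map mtopology euclideanreal S"
    unfolding S_def by (intro continuous_map_sum) auto
  moreover have "compactin mtopology C"
    using X xi[of 1] n by (simp add: proper_metric_space_def C_def)
  ultimately have "compact (S ` C)"
    using image_compactin by fastforce
  moreover have x1: "x 1 \<in> C"
    using xi[of 1] n S0 by (simp add: C_def)
  ultimately obtain y where y: "y \<in> C" "\<And>z. z \<in> C \<Longrightarrow> S y \<le> S z"
    using compact_attains_inf[of "S ` C"] by blast
  have yX: "y \<in> X"
    using y(1) by (simp add: C_def)
  have le: "S y \<le> S z" if "z \<in> X" for z
  proof (cases "z \<in> C")
    case False
    then have "S (x 1) < d (x 1) z"
      using that xi[of 1] n by (auto simp: C_def)
    also have "\<dots> \<le> S z"
      unfolding S_def using n member_le_sum[of 1 "{1..n}" "\<lambda>i. d (x i) z"] by simp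
    finally show ?thesis
      using y(2)[OF x1] by simp
  qed (simp add: y(2))
  have "fermat_distance n X d x = S y"
    unfolding fermat_distance_def
    by (rule Least_equality) (use yX le in \<open>auto simp: S_def\<close>)
  then show ?thesis
    using yX le by (auto simp: S_def)
qed

end

theory Submission
  imports Defs
begin

text \<open>
  Write \<open>F\<close> for the Fermat distance of \<open>x\<^sub>1, \<dots>, x\<^sub>n\<close>, write \<open>F\<^sub>i\<close> for its value after \<open>x\<^sub>i\<close> has been
  replaced by \<open>z\<close>, and put \<open>S = \<Sum>\<^sub>i F\<^sub>i\<close>, \<open>D = \<Sum>\<^sub>i d(x\<^sub>i, z)\<close>, \<open>T = \<Sum>\<^sub>j \<Sum>\<^sub>k d(x\<^sub>j, x\<^sub>k)\<close>.
  The theorem amounts to \<open>S \<ge> (3n\<^sup>2 - 4n) / (4n - 4) F\<close>, and it is the average of two lower bounds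
  for \<open>S\<close> in which \<open>D\<close> enters with opposite signs: the first is good when \<open>z\<close> is close to
  the points, the second when \<open>z\<close> is far away.

  \<^item> Replacing \<open>x\<^sub>i\<close> by \<open>z\<close> lowers the Fermat distance by at most \<open>d(x\<^sub>i, z)\<close>
    (\<open>fermat_distance_le_update\<close>), so \<open>S \<ge> n F - D\<close>.

  \<^item> By the triangle inequality, the sum of the distances from \<open>n\<close> points to a centre dominates the
    sum of their mutual distances, up to the factor \<open>2(n - 1)\<close>
    (\<open>pairwise_sum_le_star_sum\<close>). Applied to all \<open>n\<close> modified tuples this gives
    \<open>2(n - 1) S \<ge> (n - 2) T + 2(n - 1) D\<close>. Moreover \<open>T \<ge> n F\<close>, because each of the points
    \<open>x\<^sub>k\<close> is itself a candidate for the centre. Hence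
    \<open>S \<ge> n(n - 2) / (2(n - 1)) F + D\<close>.

  Adding the two bounds eliminates \<open>D\<close>.
\<close>

section \<open>Sums of mutual distances\<close>

text \<open>
  Each mutual distance is at most the sum of the two distances to the centre \<open>y\<close>, and every point
  takes part in \<open>card I - 1\<close> unordered pairs, each of which is counted twice.
\<close>
lemma (in Metric_space) pairwise_sum_le_star_sum:
  assumes I: "finite I" and p: "\<And>j. j \<in> I \<Longrightarrow> p j \<in> M" and y: "y \<in> M"
  shows "(\<Sum>j\<in>I. \<Sum>k\<in>I. d (p j) (p k)) \<le> 2 * (real (card I) - 1) * (\<Sum>j\<in>I. d (p j) y)"
proof -
  let ?s = "\<Sum>j\<in>I. d (p j) y"
  have row: "(\<Sum>k\<in>I. d (p j) (p k)) \<le> (real (card I) - 2) * d (p j) y + ?s" if j: "j \<in> I" for j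
  proof -
    have "(\<Sum>k\<in>I. d (p j) (p k)) = (\<Sum>k\<in>I - {j}. d (p j) (p k))"
      using I j p by (simp add: sum.remove)
    also have "\<dots> \<le> (\<Sum>k\<in>I - {j}. d (p j) y + d (p k) y)"
      using p j y by (intro sum_mono) (metis DiffD1 triangle commute)
    also have "\<dots> = (real (card I) - 1) * d (p j) y + (?s - d (p j) y)"
    proof -
      have "card I \<ge> 1"
        using I j card_gt_0_iff[of I] by auto
      then show ?thesis
        using I j by (simp add: sum.distrib sum.remove of_nat_diff)
    qed
    finally show ?thesis
      by (simp add: algebra_simps)
  qed
  have "(\<Sum>j\<in>I. \<Sum>k\<in>I. d (p j) (p k)) \<le> (\<Sum>j\<in>I. (real (card I) - 2) * d (p j) y + ?s)"
    by (rule sum_mono) (rule row)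
  also have "\<dots> = (real (card I) - 2) * ?s + real (card I) * ?s"
    by (simp add: sum.distrib sum_distrib_left)
  finally show ?thesis
    by (simp add: algebra_simps)
qed

lemma (in Metric_space) pairwise_sum_update:
  assumes I: "finite I" "i \<in> I" and p: "\<And>j. j \<in> I \<Longrightarrow> p j \<in> M" and z: "z \<in> M"
  shows "(\<Sum>j\<in>I. \<Sum>k\<in>I. d ((p(i := z)) j) ((p(i := z)) k))
       = (\<Sum>j\<in>I. \<Sum>k\<in>I. d (p j) (p k)) - 2 * (\<Sum>k\<in>I. d (p i) (p k))
         + 2 * (\<Sum>k\<in>I. d (p k) z) - 2 * d (p i) z"
proof -
  \<comment> \<open>Split off the row and the column of \<open>i\<close>; the diagonal entry vanishes.\<close>
  have split: "(\<Sum>j\<in>I. \<Sum>k\<in>I. d (q j) (q k))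
      = 2 * (\<Sum>k\<in>I - {i}. d (q k) (q i)) + (\<Sum>j\<in>I - {i}. \<Sum>k\<in>I - {i}. d (q j) (q k))"
    if "q i \<in> M" for q
  proof -
    have "(\<Sum>k\<in>I - {i}. d (q i) (q k)) = (\<Sum>k\<in>I - {i}. d (q k) (q i))"
      by (simp add: commute)
    then show ?thesis
      using I that by (simp add: sum.remove[of I i] sum.distrib)
  qed
  have "(\<Sum>k\<in>I. d (p i) (p k)) = (\<Sum>k\<in>I - {i}. d (p k) (p i))"
    using I p by (simp add: sum.remove[of I i] commute)
  moreover have "(\<Sum>k\<in>I. d (p k) z) - d (p i) z = (\<Sum>k\<in>I - {i}. d (p k) z)"
    using I by (simp add: sum.remove[of I i])
  moreover have "(\<Sum>k\<in>I - {i}. d ((p(i := z)) k) ((p(i := z)) i)) = (\<Sum>k\<in>I - {i}. d (p k) z)"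
    by (rule sum.cong) auto
  moreover have "(\<Sum>j\<in>I - {i}. \<Sum>k\<in>I - {i}. d ((p(i := z)) j) ((p(i := z)) k))
      = (\<Sum>j\<in>I - {i}. \<Sum>k\<in>I - {i}. d (p j) (p k))"
    by (intro sum.cong) auto
  ultimately show ?thesis
    using split[of p] split[of "p(i := z)"] p z I by (simp only: fun_upd_same)
qed

text \<open>
  A distance \<open>d (p j) (p k)\<close> with \<open>j \<noteq> k\<close> survives all replacements except those of \<open>j\<close> and \<open>k\<close>,
  and \<open>d (p k) z\<close> arises from every replacement except that of \<open>k\<close>.
\<close>
lemma (in Metric_space) sum_pairwise_sum_updates:
  assumes I: "finite I" and p: "\<And>j. j \<in> I \<Longrightarrow> p j \<in> M" and z: "z \<in> M"
  shows "(\<Sum>i\<in>I. \<Sum>j\<in>I. \<Sum>k\<in>I. d ((p(i := z)) j) ((p(i := z)) k))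
       = (real (card I) - 2) * (\<Sum>j\<in>I. \<Sum>k\<in>I. d (p j) (p k))
         + 2 * (real (card I) - 1) * (\<Sum>k\<in>I. d (p k) z)"
proof -
  have "(\<Sum>i\<in>I. \<Sum>j\<in>I. \<Sum>k\<in>I. d ((p(i := z)) j) ((p(i := z)) k))
      = (\<Sum>i\<in>I. (\<Sum>j\<in>I. \<Sum>k\<in>I. d (p j) (p k)) - 2 * (\<Sum>k\<in>I. d (p i) (p k))
         + 2 * (\<Sum>k\<in>I. d (p k) z) - 2 * d (p i) z)"
    by (rule sum.cong[OF refl]) (rule pairwise_sum_update, use assms in auto)
  also have "\<dots> = real (card I) * (\<Sum>j\<in>I. \<Sum>k\<in>I. d (p j) (p k))
        - 2 * (\<Sum>j\<in>I. \<Sum>k\<in>I. d (p j) (p k))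
        + real (card I) * (2 * (\<Sum>k\<in>I. d (p k) z)) - 2 * (\<Sum>k\<in>I. d (p k) z)"
    by (simp only: sum.distrib sum_subtractf sum_constant sum_distrib_left[symmetric])
  finally show ?thesis
    by (simp add: algebra_simps)
qed

section \<open>Bounds for the Fermat distance\<close>

lemma fermat_distance_le_sum:
  assumes "proper_metric_space X d" and "n \<ge> 1" and "x \<in> {1..n} \<rightarrow>\<^sub>E X" and "y \<in> X"
  shows "fermat_distance n X d x \<le> (\<Sum>i=1..n. d (x i) y)"
  using fermat_distance_attained[OF assms(1-3)] assms(4) by auto

lemma PiE_update_closed:
  assumes "x \<in> I \<rightarrow>\<^sub>E X" and "i \<in> I" and "z \<in> X"
  shows "x(i := z) \<in> I \<rightarrow>\<^sub>E X"
  using assms by (auto simp: PiE_iff extensional_def)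

text \<open>
  A Fermat point of the modified tuple also serves as a centre for the original one; only the
  distance from it to the \<open>i\<close>-th point changes, by at most \<open>d (x i) z\<close>.
\<close>
lemma fermat_distance_le_update:
  assumes X: "proper_metric_space X d" and x: "x \<in> {1..n} \<rightarrow>\<^sub>E X" and z: "z \<in> X"
    and i: "i \<in> {1..n}"
  shows "fermat_distance n X d x \<le> fermat_distance n X d (x(i := z)) + d (x i) z"
proof -
  interpret Metric_space X d
    using X by (simp add: proper_metric_space_def)
  have n: "n \<ge> 1"
    using i by simp
  obtain y where y: "y \<in> X"
    and F: "fermat_distance n X d (x(i := z)) = (\<Sum>j=1..n. d ((x(i := z)) j) y)"
    using fermat_distance_attained[OF X n PiE_update_closed[OF x i z]] by blast
  have "fermat_distance n X d x \<le> (\<Sum>j=1..n. d (x j) y)"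
    by (rule fermat_distance_le_sum[OF X n x y])
  also have "\<dots> = d (x i) y + (\<Sum>j\<in>{1..n} - {i}. d (x j) y)"
    using i by (simp add: sum.remove)
  also have "\<dots> \<le> d (x i) z + (d z y + (\<Sum>j\<in>{1..n} - {i}. d (x j) y))"
    using triangle[of "x i" z y] PiE_mem[OF x i] y z by simp
  also have "d z y + (\<Sum>j\<in>{1..n} - {i}. d (x j) y) = (\<Sum>j=1..n. d ((x(i := z)) j) y)"
  proof -
    have "(\<Sum>j\<in>{1..n} - {i}. d ((x(i := z)) j) y) = (\<Sum>j\<in>{1..n} - {i}. d (x j) y)"
      by (rule sum.cong) auto
    then show ?thesis
      using sum.remove[of "{1..n}" i "\<lambda>j. d ((x(i := z)) j) y"] i by simp
  qed
  finally show ?thesis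
    using F by simp
qed

lemma pairwise_sum_le_fermat_distance:
  assumes X: "proper_metric_space X d" and n: "n \<ge> 1" and x: "x \<in> {1..n} \<rightarrow>\<^sub>E X"
  shows "(\<Sum>j=1..n. \<Sum>k=1..n. d (x j) (x k)) \<le> 2 * (real n - 1) * fermat_distance n X d x"
proof -
  interpret Metric_space X d
    using X by (simp add: proper_metric_space_def)
  obtain y where y: "y \<in> X" and F: "fermat_distance n X d x = (\<Sum>j=1..n. d (x j) y)"
    using fermat_distance_attained[OF X n x] by blast
  show ?thesis
    unfolding F using pairwise_sum_le_star_sum[of "{1..n}" x y] PiE_mem[OF x] y by simp
qed

text \<open>Each of the points is a candidate for the centre, and the least sum is at most the mean.\<close>
lemma fermat_distance_le_pairwise_sum:
  assumes X: "proper_metric_space X d" and n: "n \<ge> 1" and x: "x \<in> {1..n} \<rightarrow>\<^sub>E X"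
  shows "real n * fermat_distance n X d x \<le> (\<Sum>j=1..n. \<Sum>k=1..n. d (x j) (x k))"
proof -
  have "(\<Sum>k=1..n. fermat_distance n X d x) \<le> (\<Sum>k=1..n. \<Sum>j=1..n. d (x j) (x k))"
    by (intro sum_mono fermat_distance_le_sum[OF X n x]) (use x in auto)
  also have "\<dots> = (\<Sum>j=1..n. \<Sum>k=1..n. d (x j) (x k))"
    by (rule sum.swap)
  finally show ?thesis
    by simp
qed

lemma fermat_distance_update_sum_bound:
  assumes X: "proper_metric_space X d" and n: "n \<ge> 2" and x: "x \<in> {1..n} \<rightarrow>\<^sub>E X" and z: "z \<in> X"
  shows "(3 * (real n)\<^sup>2 - 4 * real n) * fermat_distance n X d x
           \<le> (4 * real n - 4) * (\<Sum>i=1..n. fermat_distance n X d (x(i := z)))"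
proof -
  interpret Metric_space X d
    using X by (simp add: proper_metric_space_def)
  define F where "F = fermat_distance n X d x"
  define S where "S = (\<Sum>i=1..n. fermat_distance n X d (x(i := z)))"
  define D where "D = (\<Sum>i=1..n. d (x i) z)"
  define T where "T = (\<Sum>j=1..n. \<Sum>k=1..n. d (x j) (x k))"
  have n1: "n \<ge> 1"
    using n by simp
  have "(\<Sum>i=1..n. F) \<le> (\<Sum>i=1..n. fermat_distance n X d (x(i := z)) + d (x i) z)"
    unfolding F_def by (rule sum_mono) (rule fermat_distance_le_update[OF X x z])
  then have far: "real n * F \<le> S + D"
    by (simp add: sum.distrib S_def D_def)
  have "(real n - 2) * T + 2 * (real n - 1) * D
      = (\<Sum>i=1..n. \<Sum>j=1..n. \<Sum>k=1..n. d ((x(i := z)) j) ((x(i := z)) k))"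
    using sum_pairwise_sum_updates[of "{1..n}" x z] PiE_mem[OF x] z by (simp add: T_def D_def)
  also have "\<dots> \<le> (\<Sum>i=1..n. 2 * (real n - 1) * fermat_distance n X d (x(i := z)))"
    by (intro sum_mono pairwise_sum_le_fermat_distance[OF X n1] PiE_update_closed[OF x _ z])
  also have "\<dots> = 2 * (real n - 1) * S"
    by (simp add: S_def sum_distrib_left)
  finally have near: "(real n - 2) * T + 2 * (real n - 1) * D \<le> 2 * (real n - 1) * S" .
  have "(real n - 2) * (real n * F) \<le> (real n - 2) * T"
    unfolding F_def T_def
    by (rule mult_left_mono[OF fermat_distance_le_pairwise_sum[OF X n1 x]]) (use n in simp)
  moreover have "2 * (real n - 1) * (real n * F) \<le> 2 * (real n - 1) * (S + D)"
    by (rule mult_left_mono[OF far]) (use n in simp)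
  ultimately have
    "(real n - 2) * (real n * F) + 2 * (real n - 1) * (real n * F) \<le> 4 * (real n - 1) * S"
    using near by (simp add: algebra_simps)
  then show ?thesis
    unfolding F_def[symmetric] S_def[symmetric] by (simp add: algebra_simps power2_eq_square)
qed

section \<open>The best constant\<close>

theorem proposition3p4:
  fixes X :: "'a set" and d :: "'a \<Rightarrow> 'a \<Rightarrow> real" and n :: nat
  assumes "proper_metric_space X d" and "n \<ge> 2"
  shows "best_constant n X (fermat_distance n X d)
           \<le> (4 * real n - 4) / (3 * (real n)\<^sup>2 - 4 * real n)"
  unfolding best_constant_def
proof (rule cInf_lower)
  have n: "real n \<ge> 2"
    using assms(2) by simp
  have "3 * (real n)\<^sup>2 - 4 * real n = real n * (3 * real n - 4)"
    by (simp add: power2_eq_square algebra_simps)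
  then have pos: "3 * (real n)\<^sup>2 - 4 * real n > 0"
    using n by simp
  have "0 \<le> (3 * real n - 2) * (real n - 2)"
    using n by simp
  then have "4 * real n - 4 \<le> 3 * (real n)\<^sup>2 - 4 * real n"
    by (simp add: algebra_simps power2_eq_square)
  moreover have "fermat_distance n X d x
      \<le> (4 * real n - 4) / (3 * (real n)\<^sup>2 - 4 * real n)
          * (\<Sum>i=1..n. fermat_distance n X d (x(i := z)))"
    if "x \<in> {1..n} \<rightarrow>\<^sub>E X" "z \<in> X" for x z
    using fermat_distance_update_sum_bound[OF assms that] pos
    by (simp add: pos_le_divide_eq mult.commute)
  ultimately show "(4 * real n - 4) / (3 * (real n)\<^sup>2 - 4 * real n)
      \<in> {K. 0 < K \<and> K \<le> 1 \<and> (\<forall>x \<in> {1..n} \<rightarrow>\<^sub>E X. \<forall>z\<in>X.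
            fermat_distance n X d x \<le> K * (\<Sum>i=1..n. fermat_distance n X d (x(i := z))))}"
    using pos n by simp
  show "bdd_below {K. 0 < K \<and> K \<le> 1 \<and> (\<forall>x \<in> {1..n} \<rightarrow>\<^sub>E X. \<forall>z\<in>X.
            fermat_distance n X d x \<le> K * (\<Sum>i=1..n. fermat_distance n X d (x(i := z))))}"
    by (rule bdd_belowI[of _ 0]) auto
qed

end
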